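(* Let $n\ge 2$, let $b\in\{1,-1\}$, let $c\ge 0$ and $d$ be real numbers with $\lambda=c-d\neq 0$, and let $Q$ be the real symmetric $n\times n$ tridiagonal matrix with $Q_{11}=Q_{nn}=d$, $Q_{ii}=c$ for $2\le i\le n-1$, $Q_{i,i+1}=Q_{i+1,i}=-b$ for $1\le i\le n-1$, and all other entries $0$. Let $\beta_i = U_i(c/2)-\lambda U_{i-1}(c/2)$ for $i=0,1,\dots,n-1$. Then $Q^{-1}$ exists if and only if $d\beta_{n-1}-\beta_{n-2}\neq 0$. If $Q^{-1}$ exists, then it is symmetric and $Q^{-1}_{ij}=u_iv_j$ for all $1\le i\le j\le n$, where $$v_i=\frac{b^{i-1}\beta_{n-i}}{d\beta_{n-1}-\beta_{n-2}},\qquad u_i=b^{i-1}\beta_{i-1}\qquad (i=1,\dots,n).$$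
   Context: $U_m$ denotes the Chebyshev polynomial of the second kind: $U_{-1}(x)=0$, $U_0(x)=1$, $U_1(x)=2x$, and $U_{m+1}(x)-2xU_m(x)+U_{m-1}(x)=0$ for $m\ge 1$. Here $Q^{-1}_{ij}$ is the $(i,j)$ entry of $Q^{-1}$. *)

theory Defs
  imports "Jordan_Normal_Form.Matrix" "HOL-Computational_Algebra.Polynomial" Complex_Main
begin

fun chebyshev_U_nat :: "nat \<Rightarrow> real poly" where
  "chebyshev_U_nat 0 = 1"
| "chebyshev_U_nat (Suc 0) = [:0, 2:]"
| "chebyshev_U_nat (Suc (Suc m)) = [:0, 2:] * chebyshev_U_nat (Suc m) - chebyshev_U_nat m"

text \<open>The index is an integer so that \<open>U\<^sub>-\<^sub>1 = 0\<close> can be written; indices below \<open>-1\<close> are not used.\<close>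

definition chebyshev_U :: "int \<Rightarrow> real poly" where
  "chebyshev_U m = (if m < 0 then 0 else chebyshev_U_nat (nat m))"

lemma chebyshev_U_initial:
  "chebyshev_U (-1) = 0" "chebyshev_U 0 = 1" "chebyshev_U 1 = [:0, 2:]"
  by (simp_all add: chebyshev_U_def)

lemma chebyshev_U_rec:
  assumes "m \<ge> 1"
  shows "chebyshev_U (m + 1) - [:0, 2:] * chebyshev_U m + chebyshev_U (m - 1) = 0"
proof -
  obtain k where "m = int (Suc k)"
    using assms by (metis Suc_le_D nat_0_le nat_mono nat_one_as_int nat_le_iff zero_le_one order_trans of_nat_1 One_nat_def)
  then have "nat (m + 1) = Suc (Suc k)" "nat m = Suc k" "nat (m - 1) = k"
    by simp_all
  with assms show ?thesis
    by (simp add: chebyshev_U_def)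
qed

text \<open>Rows and columns of matrices are indexed from \<open>0\<close>, so the corner entries sit at
  \<open>(0, 0)\<close> and \<open>(n - 1, n - 1)\<close>. In contrast, the indices of \<open>u_seq\<close> and \<open>v_seq\<close> below
  run through \<open>1, \<dots>, n\<close>.\<close>

definition tridiag :: "nat \<Rightarrow> real \<Rightarrow> real \<Rightarrow> real \<Rightarrow> real mat" where
  "tridiag n b c d = mat n n (\<lambda>(i, j).
     if i = j then (if i = 0 \<or> i = n - 1 then d else c)
     else if j = i + 1 \<or> i = j + 1 then - b
     else 0)"

definition beta :: "real \<Rightarrow> real \<Rightarrow> nat \<Rightarrow> real" where
  "beta c d i = poly (chebyshev_U (int i)) (c / 2)
     - (c - d) * poly (chebyshev_U (int i - 1)) (c / 2)"

definition u_seq :: "real \<Rightarrow> real \<Rightarrow> real \<Rightarrow> nat \<Rightarrow> real" where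
  "u_seq b c d i = b ^ (i - 1) * beta c d (i - 1)"

definition v_seq :: "nat \<Rightarrow> real \<Rightarrow> real \<Rightarrow> real \<Rightarrow> nat \<Rightarrow> real" where
  "v_seq n b c d i =
     b ^ (i - 1) * beta c d (n - i) / (d * beta c d (n - 1) - beta c d (n - 2))"

end

theory Submission
  imports Defs "Jordan_Normal_Form.Determinant"
begin

text \<open>Let \<open>u\<close> solve every row of \<open>Q x = 0\<close> but the last, and \<open>v\<close> every row but the first. Gluing
  \<open>u\<close> and \<open>v\<close> along the diagonal gives a discrete Green's function \<open>G\<close> with \<open>Q G = D I\<close>: off the
  diagonal only one of the two solutions is seen, and on the diagonal consecutive entries share
  one Casoratian term, so that they are all equal to \<open>u\<^sub>0\<close> times the first entry of \<open>Q v\<close>. The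
  recurrence of the \<open>\<beta>\<^sub>i\<close> provides \<open>u\<close>, and \<open>v\<close> is the reversal of \<open>u\<close> up to sign, which gives
  \<open>D = d \<beta>\<^sub>n\<^sub>-\<^sub>1 - \<beta>\<^sub>n\<^sub>-\<^sub>2\<close>. As \<open>G \<noteq> 0\<close>, the matrix \<open>Q\<close> is invertible exactly if \<open>D \<noteq> 0\<close>.\<close>

lemma transpose_smult_mat: "transpose_mat (k \<cdot>\<^sub>m A) = k \<cdot>\<^sub>m transpose_mat A"
  by (rule eq_matI) auto

lemma scalar_smult_left_inverse:
  fixes A B R :: "'a::comm_ring_1 mat"
  assumes carrier: "A \<in> carrier_mat n n" "B \<in> carrier_mat n n" "R \<in> carrier_mat n n"
    and AB: "A * B = k \<cdot>\<^sub>m 1\<^sub>m n" and RA: "R * A = 1\<^sub>m n"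
  shows "k \<cdot>\<^sub>m R = B"
proof -
  have "k \<cdot>\<^sub>m R = R * (A * B)"
    using carrier by (simp add: AB mult_smult_distrib[OF _ one_carrier_mat])
  also have "\<dots> = R * A * B"
    using carrier by (simp add: assoc_mult_mat)
  also have "\<dots> = B"
    using carrier by (simp add: RA)
  finally show ?thesis .
qed

lemma left_inverse_of_scalar_mult:
  fixes A B R :: "'a::field mat"
  assumes carrier: "A \<in> carrier_mat n n" "B \<in> carrier_mat n n" "R \<in> carrier_mat n n"
    and AB: "A * B = k \<cdot>\<^sub>m 1\<^sub>m n" and nonzero: "B \<noteq> 0\<^sub>m n n" and RA: "R * A = 1\<^sub>m n"
  shows "k \<noteq> 0" and "R = inverse k \<cdot>\<^sub>m B"
proof -
  have kR: "k \<cdot>\<^sub>m R = B"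
    using carrier AB RA by (rule scalar_smult_left_inverse)
  show "k \<noteq> 0"
  proof
    assume "k = 0"
    with kR carrier(3) have "B = 0\<^sub>m n n"
      by (auto intro: eq_matI)
    with nonzero show False ..
  qed
  then show "R = inverse k \<cdot>\<^sub>m B"
    by (intro eq_matI) (simp_all flip: kR)
qed

lemma invertible_mat_iff_scalar_nonzero:
  fixes A B :: "'a::field mat"
  assumes A: "A \<in> carrier_mat n n" and B: "B \<in> carrier_mat n n"
    and AB: "A * B = k \<cdot>\<^sub>m 1\<^sub>m n" and nonzero: "B \<noteq> 0\<^sub>m n n"
  shows "invertible_mat A \<longleftrightarrow> k \<noteq> 0"
proof
  assume "invertible_mat A"
  then obtain R where AR: "A * R = 1\<^sub>m n" and RA: "R * A = 1\<^sub>m (dim_row R)"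
    using A by (auto simp: invertible_mat_def inverts_mat_def)
  have "dim_row R = n" "dim_col R = n"
    using arg_cong[OF RA, of dim_col] arg_cong[OF AR, of dim_col] A by simp_all
  then have "R \<in> carrier_mat n n"
    by auto
  moreover have "R * A = 1\<^sub>m n"
    using RA \<open>dim_row R = n\<close> by simp
  ultimately show "k \<noteq> 0"
    using left_inverse_of_scalar_mult(1)[OF A B _ AB nonzero] by simp
next
  assume "k \<noteq> 0"
  then have right: "A * (inverse k \<cdot>\<^sub>m B) = 1\<^sub>m n"
    using A B by (simp add: mult_smult_distrib AB) (auto intro: eq_matI)
  have left: "(inverse k \<cdot>\<^sub>m B) * A = 1\<^sub>m n"
    using A B by (intro mat_mult_left_right_inverse[OF _ _ right]) auto
  show "invertible_mat A"
    using A B left right by (auto simp: invertible_mat_def inverts_mat_def)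
qed

definition jacobi_mat :: "nat \<Rightarrow> (nat \<Rightarrow> 'a::zero) \<Rightarrow> (nat \<Rightarrow> 'a) \<Rightarrow> 'a mat" where
  "jacobi_mat n a e = mat n n (\<lambda>(i, j).
     if i = j then a i else if j = Suc i then e i else if i = Suc j then e j else 0)"

definition jacobi_op ::
    "nat \<Rightarrow> (nat \<Rightarrow> 'a::semiring_0) \<Rightarrow> (nat \<Rightarrow> 'a) \<Rightarrow> (nat \<Rightarrow> 'a) \<Rightarrow> nat \<Rightarrow> 'a" where
  "jacobi_op n a e f i =
     (if i = 0 then 0 else e (i - 1) * f (i - 1)) + a i * f i
       + (if Suc i < n then e i * f (Suc i) else 0)"

lemma sum_jacobi_mat_row:
  assumes "i < n"
  shows "(\<Sum>k = 0..<n. jacobi_mat n a e $$ (i, k) * f k) = jacobi_op n a e f i"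
proof -
  have "(\<Sum>k = 0..<n. jacobi_mat n a e $$ (i, k) * f k)
      = (\<Sum>k = 0..<n. (if k = i - 1 then (if i = 0 then 0 else e k * f k) else 0)
          + (if k = i then a k * f k else 0) + (if k = Suc i then e i * f k else 0))"
    using assms by (intro sum.cong) (auto simp: jacobi_mat_def)
  also have "\<dots> = jacobi_op n a e f i"
    using assms less_imp_diff_less[OF assms, of 1] by (simp add: sum.distrib jacobi_op_def)
  finally show ?thesis .
qed

lemma jacobi_op_mult_left:
  fixes a :: "nat \<Rightarrow> 'a::comm_semiring_0"
  shows "jacobi_op n a e (\<lambda>k. z * f k) i = z * jacobi_op n a e f i"
  by (simp add: jacobi_op_def algebra_simps)

lemma jacobi_op_reverse:
  assumes "i < n" and a: "a (n - Suc i) = a i"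
    and e: "\<And>k. Suc k < n \<Longrightarrow> e (n - Suc (Suc k)) = e k"
  shows "jacobi_op n a e (\<lambda>k. f (n - Suc k)) i = jacobi_op n a e f (n - Suc i)"
proof -
  obtain m where n: "n = Suc (i + m)"
    using \<open>i < n\<close> less_imp_Suc_add by blast
  have "e m = e (i - 1)" if "0 < i"
    using that e[of "i - 1"] n by simp
  moreover have "e (m - 1) = e i" if "0 < m"
    using that e[of i] n by simp
  ultimately show ?thesis
    using a by (cases i; cases m) (simp_all add: n jacobi_op_def add_ac)
qed

definition green_kernel :: "(nat \<Rightarrow> 'a::times) \<Rightarrow> (nat \<Rightarrow> 'a) \<Rightarrow> nat \<Rightarrow> nat \<Rightarrow> 'a" where
  "green_kernel u v i j = u (min i j) * v (max i j)"

definition green_mat :: "nat \<Rightarrow> (nat \<Rightarrow> 'a::times) \<Rightarrow> (nat \<Rightarrow> 'a) \<Rightarrow> 'a mat" where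
  "green_mat n u v = mat n n (\<lambda>(i, j). green_kernel u v i j)"

lemma green_mat_carrier [simp]: "green_mat n u v \<in> carrier_mat n n"
  by (simp add: green_mat_def)

lemma index_green_mat:
  "i \<le> j \<Longrightarrow> j < n \<Longrightarrow> green_mat n u v $$ (i, j) = u i * v j"
  by (simp add: green_mat_def green_kernel_def)

lemma transpose_green_mat: "transpose_mat (green_mat n u v) = green_mat n u v"
  by (rule eq_matI) (auto simp: green_mat_def green_kernel_def min.commute max.commute)

definition casoratian :: "(nat \<Rightarrow> 'a::ring) \<Rightarrow> (nat \<Rightarrow> 'a) \<Rightarrow> nat \<Rightarrow> 'a" where
  "casoratian u v i = u i * v (Suc i) - u (Suc i) * v i"

lemma jacobi_op_green_kernel_above:
  fixes u v :: "nat \<Rightarrow> 'a::comm_ring"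
  assumes "i < j" and "j < n"
  shows "jacobi_op n a e (\<lambda>k. green_kernel u v k j) i = v j * jacobi_op n a e u i"
  using assms by (simp add: jacobi_op_def green_kernel_def algebra_simps)

lemma jacobi_op_green_kernel_below:
  fixes u v :: "nat \<Rightarrow> 'a::comm_ring"
  assumes "j < i"
  shows "jacobi_op n a e (\<lambda>k. green_kernel u v k j) i = u j * jacobi_op n a e v i"
proof -
  have "j \<le> i - 1" "j \<le> i" "j \<le> Suc i"
    using assms by simp_all
  then show ?thesis
    by (simp add: jacobi_op_def green_kernel_def min.absorb2 max.absorb1 algebra_simps)
qed

lemma jacobi_op_green_kernel_diag_eq_left:
  fixes u v :: "nat \<Rightarrow> 'a::comm_ring"
  assumes "Suc i < n"
  shows "jacobi_op n a e (\<lambda>k. green_kernel u v k i) i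
    = v i * jacobi_op n a e u i + e i * casoratian u v i"
  using assms by (simp add: jacobi_op_def green_kernel_def casoratian_def algebra_simps)

lemma jacobi_op_green_kernel_diag_eq_right:
  fixes u v :: "nat \<Rightarrow> 'a::comm_ring"
  shows "jacobi_op n a e (\<lambda>k. green_kernel u v k (Suc i)) (Suc i)
    = u (Suc i) * jacobi_op n a e v (Suc i) + e i * casoratian u v i"
  by (simp add: jacobi_op_def green_kernel_def casoratian_def algebra_simps)

lemma jacobi_op_green_kernel_diag:
  fixes u v :: "nat \<Rightarrow> 'a::comm_ring"
  assumes u: "\<And>i. Suc i < n \<Longrightarrow> jacobi_op n a e u i = 0"
    and v: "\<And>i. 0 < i \<Longrightarrow> i < n \<Longrightarrow> jacobi_op n a e v i = 0"
    and "i < n"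
  shows "jacobi_op n a e (\<lambda>k. green_kernel u v k i) i = u 0 * jacobi_op n a e v 0"
  using \<open>i < n\<close>
proof (induction i)
  case 0
  show ?case
    by (simp add: jacobi_op_def green_kernel_def algebra_simps)
next
  case (Suc i)
  have "jacobi_op n a e (\<lambda>k. green_kernel u v k (Suc i)) (Suc i) = e i * casoratian u v i"
    using Suc.prems by (simp add: jacobi_op_green_kernel_diag_eq_right v)
  also have "\<dots> = jacobi_op n a e (\<lambda>k. green_kernel u v k i) i"
    using Suc.prems by (simp add: jacobi_op_green_kernel_diag_eq_left u)
  finally show ?case
    using Suc by simp
qed

lemma jacobi_op_green_kernel:
  fixes u v :: "nat \<Rightarrow> 'a::comm_ring"
  assumes u: "\<And>i. Suc i < n \<Longrightarrow> jacobi_op n a e u i = 0"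
    and v: "\<And>i. 0 < i \<Longrightarrow> i < n \<Longrightarrow> jacobi_op n a e v i = 0"
    and "i < n" and "j < n"
  shows "jacobi_op n a e (\<lambda>k. green_kernel u v k j) i
    = (if i = j then u 0 * jacobi_op n a e v 0 else 0)"
proof -
  consider "i < j" | "j < i" | "i = j"
    by linarith
  then show ?thesis
  proof cases
    assume "i < j"
    with u \<open>j < n\<close> show ?thesis
      by (simp add: jacobi_op_green_kernel_above)
  next
    assume "j < i"
    with v \<open>i < n\<close> show ?thesis
      by (simp add: jacobi_op_green_kernel_below)
  next
    assume "i = j"
    with jacobi_op_green_kernel_diag[OF u v \<open>i < n\<close>] show ?thesis
      by simp
  qed
qed

lemma jacobi_mat_mult_green_mat:
  fixes u v :: "nat \<Rightarrow> 'a::comm_ring_1"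
  assumes u: "\<And>i. Suc i < n \<Longrightarrow> jacobi_op n a e u i = 0"
    and v: "\<And>i. 0 < i \<Longrightarrow> i < n \<Longrightarrow> jacobi_op n a e v i = 0"
  shows "jacobi_mat n a e * green_mat n u v = (u 0 * jacobi_op n a e v 0) \<cdot>\<^sub>m 1\<^sub>m n"
    (is "?J * ?G = ?D \<cdot>\<^sub>m _")
proof (rule eq_matI)
  fix i j
  assume "i < dim_row (?D \<cdot>\<^sub>m 1\<^sub>m n)" "j < dim_col (?D \<cdot>\<^sub>m 1\<^sub>m n)"
  then have ij: "i < n" "j < n"
    by simp_all
  have dims: "dim_row ?J = n" "dim_col ?J = n" "dim_row ?G = n" "dim_col ?G = n"
    by (simp_all add: jacobi_mat_def green_mat_def)
  have "(?J * ?G) $$ (i, j) = (\<Sum>k = 0..<n. ?J $$ (i, k) * green_kernel u v k j)"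
    using ij by (simp add: dims scalar_prod_def) (simp add: green_mat_def)
  also have "\<dots> = jacobi_op n a e (\<lambda>k. green_kernel u v k j) i"
    using ij(1) by (rule sum_jacobi_mat_row)
  also have "\<dots> = (?D \<cdot>\<^sub>m 1\<^sub>m n) $$ (i, j)"
    using ij by (simp add: jacobi_op_green_kernel[OF u v])
  finally show "(?J * ?G) $$ (i, j) = (?D \<cdot>\<^sub>m 1\<^sub>m n) $$ (i, j)" .
qed (simp_all add: jacobi_mat_def green_mat_def)

lemma poly_chebyshev_U_rec:
  assumes "m \<ge> 0"
  shows "poly (chebyshev_U (m + 1)) x
    = 2 * x * poly (chebyshev_U m) x - poly (chebyshev_U (m - 1)) x"
proof (cases "m = 0")
  case True
  then show ?thesis
    by (simp add: chebyshev_U_initial)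
next
  case False
  then have "chebyshev_U (m + 1) = [:0, 2:] * chebyshev_U m - chebyshev_U (m - 1)"
    using assms chebyshev_U_rec[of m] by (simp add: algebra_simps)
  then show ?thesis
    by simp
qed

lemma beta_0 [simp]: "beta c d 0 = 1"
  by (simp add: beta_def chebyshev_U_initial)

lemma beta_Suc_0 [simp]: "beta c d (Suc 0) = d"
  by (simp add: beta_def chebyshev_U_initial)

lemma beta_Suc_Suc: "beta c d (Suc (Suc i)) = c * beta c d (Suc i) - beta c d i"
proof -
  define U where "U m = poly (chebyshev_U m) (c / 2)" for m
  have U_rec: "U (m + 1) = c * U m - U (m - 1)" if "m \<ge> 0" for m
    using poly_chebyshev_U_rec[OF that, of "c / 2"] by (simp add: U_def)
  have "beta c d (Suc (Suc i)) = U (int i + 1 + 1) - (c - d) * U (int i + 1)"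
    by (simp add: beta_def U_def add_ac)
  also have "\<dots> = (c * U (int i + 1) - U (int i)) - (c - d) * (c * U (int i) - U (int i - 1))"
    using U_rec[of "int i + 1"] U_rec[of "int i"] by simp
  also have "\<dots> = c * beta c d (Suc i) - beta c d i"
    by (simp add: beta_def U_def algebra_simps)
  finally show ?thesis .
qed

definition corner_diag :: "nat \<Rightarrow> 'a \<Rightarrow> 'a \<Rightarrow> nat \<Rightarrow> 'a" where
  "corner_diag n c d i = (if i = 0 \<or> i = n - 1 then d else c)"

lemma tridiag_carrier [simp]: "tridiag n b c d \<in> carrier_mat n n"
  by (simp add: tridiag_def)

lemma tridiag_eq_jacobi_mat: "tridiag n b c d = jacobi_mat n (corner_diag n c d) (\<lambda>_. - b)"
  by (rule eq_matI) (auto simp: tridiag_def jacobi_mat_def corner_diag_def)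

definition left_solution :: "real \<Rightarrow> real \<Rightarrow> real \<Rightarrow> nat \<Rightarrow> real" where
  "left_solution b c d i = b ^ i * beta c d i"

definition right_solution :: "nat \<Rightarrow> real \<Rightarrow> real \<Rightarrow> real \<Rightarrow> nat \<Rightarrow> real" where
  "right_solution n b c d i = b ^ i * beta c d (n - Suc i)"

lemma jacobi_op_left_solution:
  assumes "b\<^sup>2 = 1" and "Suc i < n"
  shows "jacobi_op n (corner_diag n c d) (\<lambda>_. - b) (left_solution b c d) i = 0"
proof (cases i)
  case 0
  then show ?thesis
    using assms
    by (simp add: jacobi_op_def corner_diag_def left_solution_def flip: power2_eq_square)
next
  case (Suc k)
  have "corner_diag n c d i = c"
    using assms(2) Suc by (auto simp: corner_diag_def)
  then have "jacobi_op n (corner_diag n c d) (\<lambda>_. - b) (left_solution b c d) i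
      = b * b ^ k * ((1 - b\<^sup>2) * c * beta c d (Suc k) + (b\<^sup>2 - 1) * beta c d k)"
    using assms(2) Suc
    by (simp add: jacobi_op_def left_solution_def beta_Suc_Suc power2_eq_square
        algebra_simps)
  with assms(1) show ?thesis
    by simp
qed

lemma right_solution_eq_reverse:
  assumes "b\<^sup>2 = 1" and "i < n"
  shows "right_solution n b c d i = b ^ (n - 1) * left_solution b c d (n - Suc i)"
proof -
  obtain m where n: "n = Suc (i + m)"
    using \<open>i < n\<close> less_imp_Suc_add by blast
  have "b ^ (i + m) * b ^ m = b ^ i * (b\<^sup>2) ^ m"
    by (simp add: power_add power2_eq_square power_mult_distrib)
  with assms(1) show ?thesis
    by (simp add: right_solution_def left_solution_def n)
qed

lemma jacobi_op_right_solution: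
  assumes "b\<^sup>2 = 1" and "0 < i" and "i < n"
  shows "jacobi_op n (corner_diag n c d) (\<lambda>_. - b) (right_solution n b c d) i = 0"
proof -
  let ?L = "jacobi_op n (corner_diag n c d) (\<lambda>_. - b)"
  have "?L (right_solution n b c d) i
      = ?L (\<lambda>k. b ^ (n - 1) * left_solution b c d (n - Suc k)) i"
    using assms by (simp add: jacobi_op_def right_solution_eq_reverse)
  also have "\<dots> = b ^ (n - 1) * ?L (\<lambda>k. left_solution b c d (n - Suc k)) i"
    by (rule jacobi_op_mult_left)
  also have "\<dots> = b ^ (n - 1) * ?L (left_solution b c d) (n - Suc i)"
    using assms by (subst jacobi_op_reverse) (auto simp: corner_diag_def)
  also have "\<dots> = 0"
    using assms by (simp add: jacobi_op_left_solution)
  finally show ?thesis .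
qed

definition tridiag_green :: "nat \<Rightarrow> real \<Rightarrow> real \<Rightarrow> real \<Rightarrow> real mat" where
  "tridiag_green n b c d = green_mat n (left_solution b c d) (right_solution n b c d)"

lemma tridiag_green_carrier [simp]: "tridiag_green n b c d \<in> carrier_mat n n"
  by (simp add: tridiag_green_def)

lemma transpose_tridiag_green: "transpose_mat (tridiag_green n b c d) = tridiag_green n b c d"
  by (simp add: tridiag_green_def transpose_green_mat)

lemma tridiag_mult_tridiag_green:
  assumes "n \<ge> 2" and "b\<^sup>2 = 1"
  shows "tridiag n b c d * tridiag_green n b c d
    = (d * beta c d (n - 1) - beta c d (n - 2)) \<cdot>\<^sub>m 1\<^sub>m n"
proof -
  have "left_solution b c d 0
        * jacobi_op n (corner_diag n c d) (\<lambda>_. - b) (right_solution n b c d) 0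
      = d * beta c d (n - 1) - b\<^sup>2 * beta c d (n - 2)"
    using assms(1)
    by (simp add: jacobi_op_def corner_diag_def left_solution_def right_solution_def
        power2_eq_square numeral_2_eq_2)
  with assms(2) show ?thesis
    unfolding tridiag_eq_jacobi_mat tridiag_green_def
    by (simp add: jacobi_mat_mult_green_mat jacobi_op_left_solution jacobi_op_right_solution)
qed

lemma tridiag_green_nonzero:
  assumes "n > 0" and "b \<noteq> 0"
  shows "tridiag_green n b c d \<noteq> 0\<^sub>m n n"
proof
  assume "tridiag_green n b c d = 0\<^sub>m n n"
  then have "tridiag_green n b c d $$ (0, n - 1) = 0"
    using assms(1) by simp
  then show False
    using assms
    by (simp add: tridiag_green_def index_green_mat left_solution_def right_solution_def)
qed

text \<open>If the denominator vanishes, both sides are \<open>0\<close>.\<close>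

lemma index_tridiag_green:
  assumes "1 \<le> i" and "i \<le> j" and "j \<le> n"
  shows "tridiag_green n b c d $$ (i - 1, j - 1) / (d * beta c d (n - 1) - beta c d (n - 2))
    = u_seq b c d i * v_seq n b c d j"
  using assms
  by (simp add: tridiag_green_def index_green_mat left_solution_def right_solution_def
      u_seq_def v_seq_def)

lemma invertible_tridiag_iff:
  assumes "n \<ge> 2" and "b\<^sup>2 = 1"
  shows "invertible_mat (tridiag n b c d) \<longleftrightarrow> d * beta c d (n - 1) - beta c d (n - 2) \<noteq> 0"
proof -
  have "tridiag_green n b c d \<noteq> 0\<^sub>m n n"
    using assms by (intro tridiag_green_nonzero) auto
  with tridiag_carrier tridiag_green_carrier tridiag_mult_tridiag_green[OF assms]
  show ?thesis
    by (rule invertible_mat_iff_scalar_nonzero)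
qed

lemma tridiag_left_inverse:
  assumes "n \<ge> 2" and "b\<^sup>2 = 1"
    and "R \<in> carrier_mat n n" and "R * tridiag n b c d = 1\<^sub>m n"
  shows "R = inverse (d * beta c d (n - 1) - beta c d (n - 2)) \<cdot>\<^sub>m tridiag_green n b c d"
proof -
  have "tridiag_green n b c d \<noteq> 0\<^sub>m n n"
    using assms by (intro tridiag_green_nonzero) auto
  with tridiag_carrier tridiag_green_carrier assms(3) tridiag_mult_tridiag_green[OF assms(1,2)]
  show ?thesis
    using assms(4) by (rule left_inverse_of_scalar_mult(2))
qed

theorem theorem1:
  fixes n :: nat and b c d :: real
  assumes "n \<ge> 2" and "b \<in> {1, -1}" and "c \<ge> 0" and "c - d \<noteq> 0"
  shows "(invertible_mat (tridiag n b c d)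
            \<longleftrightarrow> d * beta c d (n - 1) - beta c d (n - 2) \<noteq> 0)
       \<and> (\<forall>R \<in> carrier_mat n n.
            inverts_mat (tridiag n b c d) R \<and> inverts_mat R (tridiag n b c d) \<longrightarrow>
              transpose_mat R = R \<and>
              (\<forall>i j. 1 \<le> i \<and> i \<le> j \<and> j \<le> n \<longrightarrow>
                 R $$ (i - 1, j - 1) = u_seq b c d i * v_seq n b c d j))"
proof (intro conjI ballI allI impI)
  have b: "b\<^sup>2 = 1"
    using assms(2) by auto
  with assms(1) show "invertible_mat (tridiag n b c d)
      \<longleftrightarrow> d * beta c d (n - 1) - beta c d (n - 2) \<noteq> 0"
    by (rule invertible_tridiag_iff)
  fix R
  assume R: "R \<in> carrier_mat n n"
    and inv: "inverts_mat (tridiag n b c d) R \<and> inverts_mat R (tridiag n b c d)"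
  have R_eq: "R = inverse (d * beta c d (n - 1) - beta c d (n - 2)) \<cdot>\<^sub>m tridiag_green n b c d"
    using R inv by (intro tridiag_left_inverse assms(1) b) (auto simp: inverts_mat_def)
  show "transpose_mat R = R"
    by (simp add: R_eq transpose_smult_mat transpose_tridiag_green)
  fix i j
  assume ij: "1 \<le> i \<and> i \<le> j \<and> j \<le> n"
  have "R $$ (i - 1, j - 1)
      = tridiag_green n b c d $$ (i - 1, j - 1) / (d * beta c d (n - 1) - beta c d (n - 2))"
    using ij carrier_matD[OF tridiag_green_carrier, of n b c d]
    by (auto simp: R_eq divide_inverse)
  with ij show "R $$ (i - 1, j - 1) = u_seq b c d i * v_seq n b c d j"
    by (simp only: index_tridiag_green)
qed

end
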